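(* Any lunar monoid is a hereditary SAP monoid. That is: let $\mathcal{M}$ be a cancellative monoid such that for all $a,b,c,d,x,y,z,w\in\mathcal{M}$, $(ax=by,\ cx=dy,\ az=bw)$ implies $cz=dw$. Then for any subsets $S_1,S_2\subset\mathcal{M}$, the compressed system $\{P_{S_1}\Gamma_t^{\mathcal{M}}P_{S_2}\}_{t\in\mathcal{M}}$ has the self-absorption property (SAP).
   Context: A monoid is a semigroup with unit (not necessarily commutative); it is cancellative if $abc=adc$ implies $b=d$. For a cancellative monoid $\mathcal{M}$ and $t\in\mathcal{M}$, $\Gamma_t^{\mathcal{M}}\in B(\ell^2(\mathcal{M}))$ is the operator whose matrix in the canonical orthonormal basis is $\Gamma_t^{\mathcal{M}}(s_1,s_2)=1$ if $s_1s_2=t$ and $0$ otherwise. For $S\subset\mathcal{M}$, $P_S$ is the orthogonal projection of $\ell^2(\mathcal{M})$ onto $\ell^2(S)$. SAP: a family $\{x_i\}_{i\in I}$ in a $C^*$-algebra $A$ has the self-absorption property (SAP) if for every $C^*$-algebra $B$ and every finitely supported family $(b_i)_{i\in I}$ in $B$, $$\Big\|\sum_{i} b_i\otimes x_i\Big\|_{B\otimes_{\min}A}=\Big\|\sum_{i} b_i\otimes x_i\otimes\overline{x}_i\Big\|_{B\otimes_{\min}A\otimes_{\min}\overline{A}} .$$ Here $\otimes_{\min}$ is the minimal tensor product, $\overline{A}$ is the complex conjugate $C^*$-algebra of $A$ and $\overline{x}$ is $x$ viewed in $\overline{A}$. For $A=B(\ell^2(S))$, $\overline{A}$ is identified with $B(\ell^2(S))$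 so that $\overline{x}$ is the entrywise complex conjugate matrix of $x$. *)

theory Defs
  imports "HOL-Analysis.Analysis"
begin

section \<open>Complex vector spaces and C*-algebras\<close>

class complex_vector = real_vector +
  fixes scaleC :: "complex \<Rightarrow> 'a \<Rightarrow> 'a" (infixr "*\<^sub>C" 75)
  assumes scaleC_add_right: "c *\<^sub>C (x + y) = c *\<^sub>C x + c *\<^sub>C y"
    and scaleC_add_left: "(c + d) *\<^sub>C x = c *\<^sub>C x + d *\<^sub>C x"
    and scaleC_scaleC: "c *\<^sub>C d *\<^sub>C x = (c * d) *\<^sub>C x"
    and scaleR_scaleC: "r *\<^sub>R x = complex_of_real r *\<^sub>C x"

text \<open>C*-algebras are not assumed to be unital, and the zero algebra is allowed.\<close>

class cstar_algebra = complex_vector + real_normed_algebra + banach +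
  fixes adj :: "'a \<Rightarrow> 'a"
  assumes norm_scaleC: "norm (c *\<^sub>C x) = cmod c * norm x"
    and mult_scaleC_left: "(c *\<^sub>C x) * y = c *\<^sub>C (x * y)"
    and mult_scaleC_right: "x * (c *\<^sub>C y) = c *\<^sub>C (x * y)"
    and adj_adj: "adj (adj x) = x"
    and adj_add: "adj (x + y) = adj x + adj y"
    and adj_scaleC: "adj (c *\<^sub>C x) = cnj c *\<^sub>C adj x"
    and adj_mult: "adj (x * y) = adj y * adj x"
    and norm_adj_mult: "norm (adj x * x) = (norm x)\<^sup>2"


section \<open>The Hilbert space of square-summable functions on a type\<close>

definition sq_summable :: "('a \<Rightarrow> complex) \<Rightarrow> bool" where
  "sq_summable f \<longleftrightarrow> (\<lambda>x. (cmod (f x))\<^sup>2) summable_on UNIV"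

lemma sq_summable_zero: "sq_summable (\<lambda>_. 0)"
  by (simp add: sq_summable_def)

lemma sq_summable_le:
  assumes "sq_summable f" "\<And>x. cmod (g x) \<le> cmod (f x)"
  shows "sq_summable g"
  unfolding sq_summable_def
proof (rule summable_on_comparison_test)
  show "(\<lambda>x. (cmod (f x))\<^sup>2) summable_on UNIV"
    using assms(1) by (simp add: sq_summable_def)
  show "(cmod (g x))\<^sup>2 \<le> (cmod (f x))\<^sup>2" for x
    using assms(2)[of x] by (simp add: power_mono)
qed simp

lemma sq_summable_scale:
  assumes "sq_summable f"
  shows "sq_summable (\<lambda>x. c * f x)"
  using assms unfolding sq_summable_def
  by (auto simp: norm_mult power_mult_distrib intro: summable_on_cmult_right)

lemma sq_summable_add:
  assumes "sq_summable f" "sq_summable g"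
  shows "sq_summable (\<lambda>x. f x + g x)"
proof -
  have *: "(cmod (f x + g x))\<^sup>2 \<le> 2 * ((cmod (f x))\<^sup>2 + (cmod (g x))\<^sup>2)" for x
  proof -
    have "(cmod (f x + g x))\<^sup>2 \<le> (cmod (f x) + cmod (g x))\<^sup>2"
      by (simp add: norm_triangle_ineq power_mono)
    also have "\<dots> \<le> 2 * ((cmod (f x))\<^sup>2 + (cmod (g x))\<^sup>2)"
      using zero_le_power2[of "cmod (f x) - cmod (g x)"]
      by (simp add: power2_diff power2_sum)
    finally show ?thesis .
  qed
  have "(\<lambda>x. 2 * ((cmod (f x))\<^sup>2 + (cmod (g x))\<^sup>2)) summable_on UNIV"
    using assms unfolding sq_summable_def
    by (intro summable_on_cmult_right summable_on_add)
  then show ?thesis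
    unfolding sq_summable_def
    by (rule summable_on_comparison_test) (use * in auto)
qed

lemma sq_summable_mult:
  assumes "sq_summable f" "sq_summable g"
  shows "(\<lambda>x. cmod (f x * g x)) summable_on UNIV"
proof -
  have *: "cmod (f x * g x) \<le> (cmod (f x))\<^sup>2 + (cmod (g x))\<^sup>2" for x
  proof -
    have "2 * (cmod (f x) * cmod (g x)) \<le> (cmod (f x))\<^sup>2 + (cmod (g x))\<^sup>2"
      using zero_le_power2[of "cmod (f x) - cmod (g x)"] by (simp add: power2_diff)
    moreover have "0 \<le> cmod (f x) * cmod (g x)" by simp
    ultimately show ?thesis unfolding norm_mult by linarith
  qed
  have "(\<lambda>x. (cmod (f x))\<^sup>2 + (cmod (g x))\<^sup>2) summable_on UNIV"
    using assms unfolding sq_summable_def by (intro summable_on_add)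
  then show ?thesis
    by (rule summable_on_comparison_test) (use * in auto)
qed

typedef 'a ell2 = "{f :: 'a \<Rightarrow> complex. sq_summable f}"
  using sq_summable_zero by blast

setup_lifting type_definition_ell2

lemma sq_summable_Rep_ell2: "sq_summable (Rep_ell2 f)"
  using Rep_ell2 by blast

lemma ell2_eqI: "(\<And>x. Rep_ell2 f x = Rep_ell2 g x) \<Longrightarrow> f = g"
  by (auto simp: Rep_ell2_inject[symmetric])

lift_definition cinner :: "'a ell2 \<Rightarrow> 'a ell2 \<Rightarrow> complex"
  is "\<lambda>f g. \<Sum>\<^sub>\<infinity>x. cnj (f x) * g x" .

instantiation ell2 :: (type) complex_vector
begin

lift_definition zero_ell2 :: "'a ell2" is "\<lambda>_. 0"
  by (rule sq_summable_zero)

lift_definition plus_ell2 :: "'a ell2 \<Rightarrow> 'a ell2 \<Rightarrow> 'a ell2" is "\<lambda>f g x. f x + g x"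
  by (rule sq_summable_add)

lift_definition uminus_ell2 :: "'a ell2 \<Rightarrow> 'a ell2" is "\<lambda>f x. - f x"
  by (simp add: sq_summable_def)

lift_definition minus_ell2 :: "'a ell2 \<Rightarrow> 'a ell2 \<Rightarrow> 'a ell2" is "\<lambda>f g x. f x - g x"
proof -
  fix f g :: "'a \<Rightarrow> complex" assume "sq_summable f" "sq_summable g"
  then have "sq_summable (\<lambda>x. f x + (- 1) * g x)"
    by (intro sq_summable_add sq_summable_scale)
  then show "sq_summable (\<lambda>x. f x - g x)" by simp
qed

lift_definition scaleR_ell2 :: "real \<Rightarrow> 'a ell2 \<Rightarrow> 'a ell2" is "\<lambda>r f x. complex_of_real r * f x"
  by (rule sq_summable_scale)

lift_definition scaleC_ell2 :: "complex \<Rightarrow> 'a ell2 \<Rightarrow> 'a ell2" is "\<lambda>c f x. c * f x"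
  by (rule sq_summable_scale)

instance
  by standard (transfer; auto simp: algebra_simps fun_eq_iff)+

end

text \<open>The real inner product is the real part of \<^const>\<open>cinner\<close>; it induces the
  \<open>\<ell>\<^sup>2\<close>-norm, see \<open>norm_ell2_sq\<close> and \<open>inner_ell2_eq\<close> below.\<close>

instantiation ell2 :: (type) real_inner
begin

definition inner_ell2 :: "'a ell2 \<Rightarrow> 'a ell2 \<Rightarrow> real" where
  "inner_ell2 f g = (\<Sum>\<^sub>\<infinity>x. Re (cnj (Rep_ell2 f x) * Rep_ell2 g x))"

definition norm_ell2 :: "'a ell2 \<Rightarrow> real" where
  "norm_ell2 f = sqrt (inner f f)"

definition dist_ell2 :: "'a ell2 \<Rightarrow> 'a ell2 \<Rightarrow> real" where
  "dist_ell2 f g = norm (f - g)"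

definition sgn_ell2 :: "'a ell2 \<Rightarrow> 'a ell2" where
  "sgn_ell2 f = f /\<^sub>R norm f"

definition uniformity_ell2 :: "('a ell2 \<times> 'a ell2) filter" where
  "uniformity_ell2 = (INF e\<in>{0<..}. principal {(x, y). dist x y < e})"

definition open_ell2 :: "'a ell2 set \<Rightarrow> bool" where
  "open_ell2 U \<longleftrightarrow> (\<forall>x\<in>U. \<forall>\<^sub>F (x', y) in uniformity. x' = x \<longrightarrow> y \<in> U)"

instance
proof
  have summ: "(\<lambda>x. Re (cnj (Rep_ell2 f x) * Rep_ell2 g x)) summable_on UNIV" for f g :: "'a ell2"
  proof (rule summable_on_Re, rule abs_summable_summable, rule sq_summable_mult)
    show "sq_summable (\<lambda>x. cnj (Rep_ell2 f x))"
      using sq_summable_Rep_ell2[of f] by (simp add: sq_summable_def)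
  qed (rule sq_summable_Rep_ell2)
  fix f g h :: "'a ell2" and r :: real
  show "dist f g = norm (f - g)" "sgn f = f /\<^sub>R norm f" "norm f = sqrt (inner f f)"
    by (simp_all add: dist_ell2_def sgn_ell2_def norm_ell2_def)
  show "uniformity = (INF e\<in>{0<..}. principal {(x::'a ell2, y). dist x y < e})"
    by (simp add: uniformity_ell2_def)
  show "open U \<longleftrightarrow> (\<forall>x\<in>U. \<forall>\<^sub>F (x', y) in uniformity. x' = x \<longrightarrow> y \<in> U)" for U :: "'a ell2 set"
    by (simp add: open_ell2_def)
  show "inner f g = inner g f"
    unfolding inner_ell2_def by (intro infsum_cong) (simp add: algebra_simps)
  show "inner (f + g) h = inner f h + inner g h"
    unfolding inner_ell2_def
    by (subst infsum_add[OF summ summ, symmetric], intro infsum_cong)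
       (simp add: plus_ell2.rep_eq algebra_simps)
  show "inner (r *\<^sub>R f) g = r * inner f g"
    unfolding inner_ell2_def
    by (subst infsum_cmult_right[OF summ, symmetric], intro infsum_cong)
       (simp add: scaleR_ell2.rep_eq algebra_simps)
  have sq: "Re (cnj z * z) = (cmod z)\<^sup>2" for z
    unfolding cmod_power2 by (simp add: power2_eq_square)
  show "0 \<le> inner f f"
    unfolding inner_ell2_def sq by (intro infsum_nonneg) simp
  show "inner f f = 0 \<longleftrightarrow> f = 0"
  proof
    assume "inner f f = 0"
    then have "(cmod (Rep_ell2 f x))\<^sup>2 = 0" for x
      using sq_summable_Rep_ell2[of f] unfolding inner_ell2_def sq sq_summable_def
      by (intro nonneg_infsum_le_0D[of "\<lambda>x. (cmod (Rep_ell2 f x))\<^sup>2" UNIV]) auto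
    then have "Rep_ell2 f = Rep_ell2 0"
      by (auto simp: zero_ell2.rep_eq)
    then show "f = 0" by (simp add: Rep_ell2_inject)
  next
    assume "f = 0"
    then show "inner f f = 0"
      by (simp add: inner_ell2_def zero_ell2.rep_eq)
  qed
qed

end

lemma norm_ell2_sq: "(norm f)\<^sup>2 = (\<Sum>\<^sub>\<infinity>x. (cmod (Rep_ell2 f x))\<^sup>2)"
proof -
  have sq: "Re (cnj z * z) = (cmod z)\<^sup>2" for z
    unfolding cmod_power2 by (simp add: power2_eq_square)
  show ?thesis
    unfolding power2_norm_eq_inner inner_ell2_def sq ..
qed

lemma inner_ell2_eq: "inner f g = Re (cinner f g)"
proof -
  have "(\<lambda>x. cnj (Rep_ell2 f x) * Rep_ell2 g x) summable_on UNIV"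
  proof (rule abs_summable_summable, rule sq_summable_mult)
    show "sq_summable (\<lambda>x. cnj (Rep_ell2 f x))"
      using sq_summable_Rep_ell2[of f] by (simp add: sq_summable_def)
  qed (rule sq_summable_Rep_ell2)
  then show ?thesis
    unfolding inner_ell2_def cinner.rep_eq by (rule infsum_Re)
qed

lemma sum_le_norm_ell2:
  assumes "finite F"
  shows "(\<Sum>x\<in>F. (cmod (Rep_ell2 f x))\<^sup>2) \<le> (norm f)\<^sup>2"
  unfolding norm_ell2_sq
  using sq_summable_Rep_ell2[of f] assms
  by (intro finite_sum_le_infsum) (auto simp: sq_summable_def)

lemma sq_summable_boundedI:
  assumes "\<And>F. finite F \<Longrightarrow> (\<Sum>x\<in>F. (cmod (f x))\<^sup>2) \<le> C"
  shows "sq_summable f" and "(\<Sum>\<^sub>\<infinity>x. (cmod (f x))\<^sup>2) \<le> C"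
proof -
  show s: "sq_summable f"
    unfolding sq_summable_def
    by (rule nonneg_bdd_above_summable_on) (use assms in \<open>auto intro!: bdd_aboveI2\<close>)
  show "(\<Sum>\<^sub>\<infinity>x. (cmod (f x))\<^sup>2) \<le> C"
    using s assms unfolding sq_summable_def by (intro infsum_le_finite_sums) auto
qed

lemma norm_ell2_le:
  assumes "\<And>F. finite F \<Longrightarrow> (\<Sum>x\<in>F. (cmod (Rep_ell2 f x))\<^sup>2) \<le> C\<^sup>2" "0 \<le> C"
  shows "norm f \<le> C"
proof (rule power2_le_imp_le)
  show "(norm f)\<^sup>2 \<le> C\<^sup>2"
    unfolding norm_ell2_sq by (rule sq_summable_boundedI(2)) (rule assms(1))
qed (rule assms(2))


section \<open>Bounded operators\<close>

text \<open>Bounded real-linear maps and their operator norm are the library's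
  \<open>\<Rightarrow>\<^sub>L\<close>; the elements of \<open>B(\<ell>\<^sup>2)\<close> are those that commute with complex scalars.\<close>

definition complex_linear :: "('a::{complex_vector,real_normed_vector} \<Rightarrow>\<^sub>L 'b::{complex_vector,real_normed_vector}) \<Rightarrow> bool"
  where "complex_linear T \<longleftrightarrow> (\<forall>c f. T (c *\<^sub>C f) = c *\<^sub>C T f)"

lift_definition ket :: "'a \<Rightarrow> 'a ell2" is "\<lambda>a x. if x = a then 1 else 0"
proof -
  fix a :: 'a
  let ?f = "\<lambda>x. (cmod (if x = a then 1 else 0))\<^sup>2"
  have "?f summable_on UNIV \<longleftrightarrow> ?f summable_on {a}"
    by (rule summable_on_cong_neutral) auto
  then show "sq_summable (\<lambda>x. if x = a then 1 else 0)"
    unfolding sq_summable_def by simp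
qed

lift_definition conj_ell2 :: "'a ell2 \<Rightarrow>\<^sub>L 'a ell2"
  is "\<lambda>f. Abs_ell2 (\<lambda>x. cnj (Rep_ell2 f x))"
proof -
  have r: "Rep_ell2 (Abs_ell2 (\<lambda>x. cnj (Rep_ell2 f x))) = (\<lambda>x. cnj (Rep_ell2 f x))" for f :: "'a ell2"
    by (rule Abs_ell2_inverse)
       (use sq_summable_Rep_ell2[of f] in \<open>simp add: sq_summable_def\<close>)
  show "bounded_linear (\<lambda>f::'a ell2. Abs_ell2 (\<lambda>x. cnj (Rep_ell2 f x)))"
  proof (rule bounded_linear_intro[where K = 1])
    fix f g :: "'a ell2" and c :: real
    show "Abs_ell2 (\<lambda>x. cnj (Rep_ell2 (f + g) x)) =
        Abs_ell2 (\<lambda>x. cnj (Rep_ell2 f x)) + Abs_ell2 (\<lambda>x. cnj (Rep_ell2 g x))"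
      by (rule ell2_eqI, unfold r, simp only: plus_ell2.rep_eq r) (simp add: plus_ell2.rep_eq case_prod_unfold)
    show "Abs_ell2 (\<lambda>x. cnj (Rep_ell2 (c *\<^sub>R f) x)) = c *\<^sub>R Abs_ell2 (\<lambda>x. cnj (Rep_ell2 f x))"
      by (rule ell2_eqI, unfold r, simp only: scaleR_ell2.rep_eq r) (simp add: scaleR_ell2.rep_eq case_prod_unfold)
    show "norm (Abs_ell2 (\<lambda>x. cnj (Rep_ell2 f x))) \<le> norm f * 1"
      by (rule norm_ell2_le) (auto simp: r sum_le_norm_ell2)
  qed
qed

text \<open>The conjugate algebra of \<open>B(\<ell>\<^sup>2)\<close> is identified with \<open>B(\<ell>\<^sup>2)\<close> itself, through
  the entrywise complex conjugation of matrices (see \<open>conj_op_matrix\<close>).\<close>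

definition conj_op :: "('a ell2 \<Rightarrow>\<^sub>L 'b ell2) \<Rightarrow> ('a ell2 \<Rightarrow>\<^sub>L 'b ell2)" where
  "conj_op T = conj_ell2 o\<^sub>L T o\<^sub>L conj_ell2"


section \<open>Tensor products\<close>

text \<open>The Hilbert space tensor product of \<open>\<ell>\<^sup>2('a)\<close> and \<open>\<ell>\<^sup>2('b)\<close> is \<open>\<ell>\<^sup>2('a \<times> 'b)\<close>.\<close>

lemma sq_summable_tensor:
  assumes f: "sq_summable f" and g: "sq_summable g"
  shows "sq_summable (\<lambda>(x, y). f x * g y)"
proof (rule sq_summable_boundedI(1))
  fix F :: "('a \<times> 'b) set" assume F: "finite F"
  have "(\<Sum>p\<in>F. (cmod (case p of (x, y) \<Rightarrow> f x * g y))\<^sup>2)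
      \<le> (\<Sum>p\<in>fst ` F \<times> snd ` F. (cmod (case p of (x, y) \<Rightarrow> f x * g y))\<^sup>2)"
    using F by (intro sum_mono2) (force simp: image_iff)+
  also have "\<dots> = (\<Sum>x\<in>fst ` F. (cmod (f x))\<^sup>2) * (\<Sum>y\<in>snd ` F. (cmod (g y))\<^sup>2)"
    by (simp add: sum_product sum.cartesian_product norm_mult power_mult_distrib case_prod_unfold)
  also have "\<dots> \<le> (\<Sum>\<^sub>\<infinity>x. (cmod (f x))\<^sup>2) * (\<Sum>\<^sub>\<infinity>y. (cmod (g y))\<^sup>2)"
    using F f g unfolding sq_summable_def
    by (intro mult_mono finite_sum_le_infsum infsum_nonneg sum_nonneg) auto
  finally show "(\<Sum>p\<in>F. (cmod (case p of (x, y) \<Rightarrow> f x * g y))\<^sup>2)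
      \<le> (\<Sum>\<^sub>\<infinity>x. (cmod (f x))\<^sup>2) * (\<Sum>\<^sub>\<infinity>y. (cmod (g y))\<^sup>2)" .
qed

lift_definition tensor_ell2 :: "'a ell2 \<Rightarrow> 'b ell2 \<Rightarrow> ('a \<times> 'b) ell2"
  is "\<lambda>f g (x, y). f x * g y"
  by (rule sq_summable_tensor)

lemma sq_summable_slice:
  assumes "sq_summable f"
  shows "sq_summable (\<lambda>x. f (x, y))"
proof -
  have "(\<lambda>p. (cmod (f p))\<^sup>2) summable_on range (\<lambda>x. (x, y))"
    using assms unfolding sq_summable_def by (rule summable_on_subset_banach) simp
  then have "((\<lambda>p. (cmod (f p))\<^sup>2) \<circ> (\<lambda>x. (x, y))) summable_on UNIV"
    by (subst (asm) summable_on_reindex) (auto simp: inj_on_def)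
  then show ?thesis by (simp add: sq_summable_def o_def)
qed

lift_definition slice :: "('a \<times> 'b) ell2 \<Rightarrow> 'b \<Rightarrow> 'a ell2" is "\<lambda>f y x. f (x, y)"
  by (rule sq_summable_slice)

lemma sum_norm_slice_le:
  fixes f :: "('a \<times> 'b) ell2"
  assumes G: "finite G"
  shows "(\<Sum>y\<in>G. (norm (slice f y))\<^sup>2) \<le> (norm f)\<^sup>2"
proof -
  have UN: "range (\<lambda>(y, x). (x, y)) = (UNIV :: ('a \<times> 'b) set)"
    by (rule surj_def[THEN iffD2]) auto
  have s0: "(\<lambda>p. (cmod (Rep_ell2 f p))\<^sup>2) summable_on UNIV"
    using sq_summable_Rep_ell2[of f] by (simp add: sq_summable_def)
  have "(\<lambda>p. (cmod (Rep_ell2 f p))\<^sup>2) summable_on range (\<lambda>(y, x). (x, y))"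
    using s0 by (rule summable_on_subset_banach) simp
  then have s: "(\<lambda>(y, x). (cmod (Rep_ell2 f (x, y)))\<^sup>2) summable_on UNIV \<times> UNIV"
    by (subst (asm) summable_on_reindex) (auto simp: inj_on_def o_def case_prod_unfold)
  have "(\<Sum>y\<in>G. (norm (slice f y))\<^sup>2) \<le> (\<Sum>\<^sub>\<infinity>y. (norm (slice f y))\<^sup>2)"
    unfolding norm_ell2_sq slice.rep_eq
    using summable_on_Sigma_banach[OF s] G
    by (intro finite_sum_le_infsum) (auto intro!: infsum_nonneg)
  also have "(\<Sum>\<^sub>\<infinity>y. (norm (slice f y))\<^sup>2) = (\<Sum>\<^sub>\<infinity>(y, x)\<in>UNIV \<times> UNIV. (cmod (Rep_ell2 f (x, y)))\<^sup>2)"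
    unfolding norm_ell2_sq slice.rep_eq by (rule infsum_Sigma'_banach[OF s])
  also have "\<dots> = (\<Sum>\<^sub>\<infinity>p\<in>range (\<lambda>(y, x). (x, y)). (cmod (Rep_ell2 f p))\<^sup>2)"
    by (subst infsum_reindex) (auto simp: inj_on_def o_def case_prod_unfold)
  also have "\<dots> = (norm f)\<^sup>2"
    unfolding norm_ell2_sq UN ..
  finally show ?thesis .
qed

lemma ampl_bound:
  fixes T :: "'a ell2 \<Rightarrow>\<^sub>L 'c ell2" and f :: "('a \<times> 'b) ell2"
  assumes F: "finite F"
  shows "(\<Sum>(x, y)\<in>F. (cmod (Rep_ell2 (T (slice f y)) x))\<^sup>2) \<le> (norm T * norm f)\<^sup>2"
proof -
  have "(\<Sum>(x, y)\<in>F. (cmod (Rep_ell2 (T (slice f y)) x))\<^sup>2)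
      \<le> (\<Sum>(x, y)\<in>fst ` F \<times> snd ` F. (cmod (Rep_ell2 (T (slice f y)) x))\<^sup>2)"
    using F by (intro sum_mono2) (force simp: image_iff)+
  also have "\<dots> = (\<Sum>y\<in>snd ` F. \<Sum>x\<in>fst ` F. (cmod (Rep_ell2 (T (slice f y)) x))\<^sup>2)"
    by (subst sum.cartesian_product[symmetric], rule sum.swap)
  also have "\<dots> \<le> (\<Sum>y\<in>snd ` F. (norm (T (slice f y)))\<^sup>2)"
    using F by (intro sum_mono sum_le_norm_ell2) auto
  also have "\<dots> \<le> (\<Sum>y\<in>snd ` F. (norm T)\<^sup>2 * (norm (slice f y))\<^sup>2)"
    unfolding power_mult_distrib[symmetric]
    by (intro sum_mono power_mono norm_blinfun norm_ge_zero)
  also have "\<dots> \<le> (norm T)\<^sup>2 * (norm f)\<^sup>2"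
    unfolding sum_distrib_left[symmetric]
    using F by (intro mult_left_mono sum_norm_slice_le) auto
  finally show ?thesis by (simp add: power_mult_distrib)
qed

lemma slice_add: "slice (f + g) y = slice f y + slice g y"
  by transfer simp

lemma slice_scaleR: "slice (r *\<^sub>R f) y = r *\<^sub>R slice f y"
  by transfer simp

lemma slice_scaleC: "slice (c *\<^sub>C f) y = c *\<^sub>C slice f y"
  by transfer simp

text \<open>\<open>ampl T\<close> is the amplification \<open>T \<otimes> 1\<close>: it applies \<open>T\<close> in the first variable.\<close>

lift_definition ampl :: "('a ell2 \<Rightarrow>\<^sub>L 'c ell2) \<Rightarrow> (('a \<times> 'b) ell2 \<Rightarrow>\<^sub>L ('c \<times> 'b) ell2)"
  is "\<lambda>T f. Abs_ell2 (\<lambda>(x, y). Rep_ell2 (T (slice f y)) x)"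
proof -
  fix T0 :: "'a ell2 \<Rightarrow> 'c ell2" assume "bounded_linear T0"
  define T where "T = Blinfun T0"
  have T: "T0 = blinfun_apply T"
    using \<open>bounded_linear T0\<close> by (simp add: T_def bounded_linear_Blinfun_apply)
  have r: "Rep_ell2 (Abs_ell2 (\<lambda>(x, y). Rep_ell2 (T (slice f y)) x)) =
      (\<lambda>(x, y). Rep_ell2 (T (slice f y)) x)" for f :: "('a \<times> 'b) ell2"
    by (rule Abs_ell2_inverse, simp, rule sq_summable_boundedI(1))
       (use ampl_bound[of _ T f] in \<open>simp add: case_prod_unfold\<close>)
  show "bounded_linear (\<lambda>f::('a \<times> 'b) ell2. Abs_ell2 (\<lambda>(x, y). Rep_ell2 (T0 (slice f y)) x))"
    unfolding T
  proof (rule bounded_linear_intro[where K = "norm T"])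
    fix f g :: "('a \<times> 'b) ell2" and c :: real
    show "Abs_ell2 (\<lambda>(x, y). Rep_ell2 (T (slice (f + g) y)) x) =
        Abs_ell2 (\<lambda>(x, y). Rep_ell2 (T (slice f y)) x) + Abs_ell2 (\<lambda>(x, y). Rep_ell2 (T (slice g y)) x)"
      by (rule ell2_eqI, unfold r, simp only: plus_ell2.rep_eq r) (simp add: plus_ell2.rep_eq case_prod_unfold slice_add blinfun.add_right)
    show "Abs_ell2 (\<lambda>(x, y). Rep_ell2 (T (slice (c *\<^sub>R f) y)) x) =
        c *\<^sub>R Abs_ell2 (\<lambda>(x, y). Rep_ell2 (T (slice f y)) x)"
      by (rule ell2_eqI, unfold r, simp only: scaleR_ell2.rep_eq r) (simp add: scaleR_ell2.rep_eq case_prod_unfold slice_scaleR blinfun.scaleR_right)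
    show "norm (Abs_ell2 (\<lambda>(x, y). Rep_ell2 (T (slice f y)) x)) \<le> norm f * norm T"
      by (rule norm_ell2_le, unfold r)
         (use ampl_bound[of _ T f] in \<open>auto simp: case_prod_unfold mult.commute\<close>)
  qed
qed

lift_definition swap_ell2 :: "('a \<times> 'b) ell2 \<Rightarrow>\<^sub>L ('b \<times> 'a) ell2"
  is "\<lambda>f. Abs_ell2 (\<lambda>(y, x). Rep_ell2 f (x, y))"
proof -
  have b: "(\<Sum>(y, x)\<in>F. (cmod (Rep_ell2 f (x, y)))\<^sup>2) \<le> (norm f)\<^sup>2"
    if "finite F" for F and f :: "('a \<times> 'b) ell2"
  proof -
    have "(\<Sum>(y, x)\<in>F. (cmod (Rep_ell2 f (x, y)))\<^sup>2) = (\<Sum>p\<in>prod.swap ` F. (cmod (Rep_ell2 f p))\<^sup>2)"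
      by (subst sum.reindex) (auto simp: case_prod_unfold prod.swap_def)
    also have "\<dots> \<le> (norm f)\<^sup>2"
      using that by (intro sum_le_norm_ell2) auto
    finally show ?thesis .
  qed
  have r: "Rep_ell2 (Abs_ell2 (\<lambda>(y, x). Rep_ell2 f (x, y))) = (\<lambda>(y, x). Rep_ell2 f (x, y))"
    for f :: "('a \<times> 'b) ell2"
    by (rule Abs_ell2_inverse, simp, rule sq_summable_boundedI(1))
       (use b[of _ f] in \<open>simp add: case_prod_unfold\<close>)
  show "bounded_linear (\<lambda>f::('a \<times> 'b) ell2. Abs_ell2 (\<lambda>(y, x). Rep_ell2 f (x, y)))"
  proof (rule bounded_linear_intro[where K = 1])
    fix f g :: "('a \<times> 'b) ell2" and c :: real
    show "Abs_ell2 (\<lambda>(y, x). Rep_ell2 (f + g) (x, y)) =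
        Abs_ell2 (\<lambda>(y, x). Rep_ell2 f (x, y)) + Abs_ell2 (\<lambda>(y, x). Rep_ell2 g (x, y))"
      by (rule ell2_eqI, unfold r, simp only: plus_ell2.rep_eq r) (simp add: plus_ell2.rep_eq case_prod_unfold)
    show "Abs_ell2 (\<lambda>(y, x). Rep_ell2 (c *\<^sub>R f) (x, y)) = c *\<^sub>R Abs_ell2 (\<lambda>(y, x). Rep_ell2 f (x, y))"
      by (rule ell2_eqI, unfold r, simp only: scaleR_ell2.rep_eq r) (simp add: scaleR_ell2.rep_eq case_prod_unfold)
    show "norm (Abs_ell2 (\<lambda>(y, x). Rep_ell2 f (x, y))) \<le> norm f * 1"
      by (rule norm_ell2_le, unfold r) (use b[of _ f] in \<open>auto simp: case_prod_unfold\<close>)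
  qed
qed

text \<open>\<open>T \<otimes> X = (T \<otimes> 1) (1 \<otimes> X)\<close>. For complex-linear \<open>T\<close> and \<open>X\<close> this is the bounded operator
  with \<open>(T \<otimes> X) (u \<otimes> v) = T u \<otimes> X v\<close>, see \<open>tensor_op_apply\<close> and \<open>complex_linear_tensor_op\<close>.\<close>

definition tensor_op :: "('a ell2 \<Rightarrow>\<^sub>L 'c ell2) \<Rightarrow> ('b ell2 \<Rightarrow>\<^sub>L 'd ell2) \<Rightarrow>
    (('a \<times> 'b) ell2 \<Rightarrow>\<^sub>L ('c \<times> 'd) ell2)"
  where "tensor_op T X = ampl T o\<^sub>L swap_ell2 o\<^sub>L ampl X o\<^sub>L swap_ell2"

lemma Rep_conj_ell2: "Rep_ell2 (conj_ell2 f) = (\<lambda>x. cnj (Rep_ell2 f x))"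
  unfolding conj_ell2.rep_eq
  by (rule Abs_ell2_inverse)
     (use sq_summable_Rep_ell2[of f] in \<open>simp add: sq_summable_def\<close>)

lemma conj_op_matrix:
  "Rep_ell2 (conj_op T (ket u)) s = cnj (Rep_ell2 (T (ket u)) s)"
proof -
  have "conj_ell2 (ket u) = ket u"
    by (rule ell2_eqI) (auto simp: Rep_conj_ell2 ket.rep_eq)
  then show ?thesis by (simp add: conj_op_def Rep_conj_ell2)
qed

lemma complex_linear_conj_op:
  assumes "complex_linear T"
  shows "complex_linear (conj_op T)"
proof -
  have c: "conj_ell2 (c *\<^sub>C f) = cnj c *\<^sub>C conj_ell2 f" for c and f :: "'d ell2"
    by (rule ell2_eqI) (auto simp: Rep_conj_ell2 scaleC_ell2.rep_eq)
  show ?thesis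
    using assms by (simp add: complex_linear_def conj_op_def c)
qed

lemma Rep_ampl: "Rep_ell2 (ampl T f) (x, y) = Rep_ell2 (T (slice f y)) x"
proof -
  have "Rep_ell2 (ampl T f) = (\<lambda>(x, y). Rep_ell2 (T (slice f y)) x)"
    unfolding ampl.rep_eq
    by (rule Abs_ell2_inverse, simp, rule sq_summable_boundedI(1))
       (use ampl_bound[of _ T f] in \<open>simp add: case_prod_unfold\<close>)
  then show ?thesis by simp
qed

lemma Rep_swap_ell2: "Rep_ell2 (swap_ell2 f) (y, x) = Rep_ell2 f (x, y)"
proof -
  have "(\<Sum>(y, x)\<in>F. (cmod (Rep_ell2 f (x, y)))\<^sup>2) \<le> (norm f)\<^sup>2" if "finite F" for F
  proof -
    have "(\<Sum>(y, x)\<in>F. (cmod (Rep_ell2 f (x, y)))\<^sup>2) = (\<Sum>p\<in>prod.swap ` F. (cmod (Rep_ell2 f p))\<^sup>2)"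
      by (subst sum.reindex) (auto simp: case_prod_unfold prod.swap_def)
    also have "\<dots> \<le> (norm f)\<^sup>2"
      using that by (intro sum_le_norm_ell2) auto
    finally show ?thesis .
  qed
  then have "sq_summable (\<lambda>(y, x). Rep_ell2 f (x, y))"
    by (intro sq_summable_boundedI(1)) (simp add: case_prod_unfold)
  then show ?thesis
    by (simp add: swap_ell2.rep_eq Abs_ell2_inverse)
qed

lemma tensor_op_apply:
  assumes T: "complex_linear T" and X: "complex_linear X"
  shows "tensor_op T X (tensor_ell2 u v) = tensor_ell2 (T u) (X v)"
proof -
  have s: "slice (tensor_ell2 f g) y = Rep_ell2 g y *\<^sub>C f" for f :: "'e ell2" and g :: "'f ell2" and y
    by (rule ell2_eqI) (simp add: slice.rep_eq tensor_ell2.rep_eq scaleC_ell2.rep_eq)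
  have sw: "swap_ell2 (tensor_ell2 f g) = tensor_ell2 g f" for f :: "'e ell2" and g :: "'f ell2"
    by (rule ell2_eqI) (auto simp: Rep_swap_ell2 tensor_ell2.rep_eq)
  have am: "ampl W (tensor_ell2 f g) = tensor_ell2 (W f) g"
    if "complex_linear W" for W :: "'e ell2 \<Rightarrow>\<^sub>L 'g ell2" and f :: "'e ell2" and g :: "'f ell2"
    by (rule ell2_eqI)
       (use that in \<open>auto simp: Rep_ampl tensor_ell2.rep_eq s complex_linear_def scaleC_ell2.rep_eq\<close>)
  show ?thesis
    by (simp add: tensor_op_def sw am T X)
qed

lemma complex_linear_tensor_op:
  assumes "complex_linear T" "complex_linear X"
  shows "complex_linear (tensor_op T X)"
proof -
  have sw: "swap_ell2 (c *\<^sub>C f) = c *\<^sub>C swap_ell2 f" for c and f :: "('e \<times> 'f) ell2"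
    by (rule ell2_eqI) (auto simp: Rep_swap_ell2 scaleC_ell2.rep_eq)
  have am: "ampl W (c *\<^sub>C f) = c *\<^sub>C ampl W f" if "complex_linear W"
    for c and W :: "'e ell2 \<Rightarrow>\<^sub>L 'g ell2" and f :: "('e \<times> 'f) ell2"
    by (rule ell2_eqI)
       (use that in \<open>auto simp: Rep_ampl slice_scaleC complex_linear_def scaleC_ell2.rep_eq\<close>)
  show ?thesis
    unfolding complex_linear_def using assms by (simp add: tensor_op_def sw am)
qed


section \<open>Minimal tensor norms and the self-absorption property\<close>

definition faithful_star_rep :: "('b::cstar_algebra \<Rightarrow> ('h ell2 \<Rightarrow>\<^sub>L 'h ell2)) \<Rightarrow> bool" where
  "faithful_star_rep \<pi> \<longleftrightarrow>
     (\<forall>a. complex_linear (\<pi> a)) \<and>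
     (\<forall>a b. \<pi> (a + b) = \<pi> a + \<pi> b) \<and>
     (\<forall>c a f. \<pi> (c *\<^sub>C a) f = c *\<^sub>C \<pi> a f) \<and>
     (\<forall>a b. \<pi> (a * b) = \<pi> a o\<^sub>L \<pi> b) \<and>
     (\<forall>a f g. cinner (\<pi> (adj a) f) g = cinner f (\<pi> a g)) \<and>
     inj \<pi>"

text \<open>For a faithful representation \<open>\<pi>\<close> of \<open>B\<close> on \<open>\<ell>\<^sup>2('h)\<close> and operators \<open>y i\<close> on \<open>\<ell>\<^sup>2('k)\<close>,
  \<open>min_norm \<pi> b y\<close> is the norm of \<open>\<Sum>i. b i \<otimes> y i\<close> in \<open>B \<otimes>\<^sub>m\<^sub>i\<^sub>n B(\<ell>\<^sup>2('k))\<close>, i.e. the operator norm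
  of its image in \<open>B(\<ell>\<^sup>2('h) \<otimes> \<ell>\<^sup>2('k))\<close>. It does not depend on \<open>\<pi>\<close>, and it is also the norm in
  \<open>B \<otimes>\<^sub>m\<^sub>i\<^sub>n A\<close> for every C*-subalgebra \<open>A\<close> of \<open>B(\<ell>\<^sup>2('k))\<close> that contains all \<open>y i\<close>. The family \<open>b\<close>
  has to be finitely supported.\<close>

definition min_norm :: "('b::cstar_algebra \<Rightarrow> ('h ell2 \<Rightarrow>\<^sub>L 'h ell2)) \<Rightarrow> ('i \<Rightarrow> 'b) \<Rightarrow>
    ('i \<Rightarrow> ('k ell2 \<Rightarrow>\<^sub>L 'k ell2)) \<Rightarrow> real"
  where "min_norm \<pi> b y = norm (\<Sum>i\<in>{i. b i \<noteq> 0}. tensor_op (\<pi> (b i)) (y i))"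

text \<open>The self-absorption property of a family in \<open>B(\<ell>\<^sup>2('k))\<close>. The two type arguments are the
  C*-algebra \<open>B\<close> and the index type of the Hilbert space on which \<open>B\<close> is represented; SAP means that
  this predicate holds for all \<open>'b\<close> and \<open>'h\<close> (every Hilbert space is of the form \<open>\<ell>\<^sup>2('h)\<close>, and every
  C*-algebra has a faithful representation). In the second norm, \<open>A \<otimes>\<^sub>m\<^sub>i\<^sub>n A\<close> conjugate acts on
  \<open>\<ell>\<^sup>2('k \<times> 'k)\<close>.\<close>

definition SAP :: "'b::cstar_algebra itself \<Rightarrow> 'h itself \<Rightarrow> ('i \<Rightarrow> ('k ell2 \<Rightarrow>\<^sub>L 'k ell2)) \<Rightarrow> bool"
  where "SAP _ _ x \<longleftrightarrow>
    (\<forall>i. complex_linear (x i)) \<and>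
    (\<forall>(\<pi> :: 'b \<Rightarrow> ('h ell2 \<Rightarrow>\<^sub>L 'h ell2)) (b :: 'i \<Rightarrow> 'b).
       faithful_star_rep \<pi> \<and> finite {i. b i \<noteq> 0} \<longrightarrow>
       min_norm \<pi> b x = min_norm \<pi> b (\<lambda>i. tensor_op (x i) (conj_op (x i))))"


section \<open>Cancellative monoids and their Gamma operators\<close>

class cancel_monoid_mult = monoid_mult +
  assumes cancel: "a * b * c = a * d * c \<Longrightarrow> b = d"

lemma cancel_left: "a * b = a * d \<longleftrightarrow> b = (d :: 'm::cancel_monoid_mult)"
  using cancel[of a b 1 d] by auto

lemma cancel_right: "b * c = d * c \<longleftrightarrow> b = (d :: 'm::cancel_monoid_mult)"
  using cancel[of 1 b c d] by auto

definition Gamma_matrix :: "'m::monoid_mult \<Rightarrow> 'm \<Rightarrow> 'm \<Rightarrow> complex" where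
  "Gamma_matrix t s1 s2 = (if s1 * s2 = t then 1 else 0)"

lemma Gamma_infsum:
  fixes t s :: "'m::cancel_monoid_mult"
  shows "(\<Sum>\<^sub>\<infinity>u. Gamma_matrix t s u * f u) =
    (if \<exists>u. s * u = t then f (THE u. s * u = t) else 0)"
proof (cases "\<exists>u. s * u = t")
  case True
  then obtain u where u: "s * u = t" by blast
  then have uu: "s * v = t \<longleftrightarrow> v = u" for v
    by (metis cancel_left)
  have "(\<Sum>\<^sub>\<infinity>v. Gamma_matrix t s v * f v) = (\<Sum>\<^sub>\<infinity>v\<in>{u}. f v)"
    by (rule infsum_cong_neutral) (auto simp: Gamma_matrix_def uu)
  then show ?thesis by (simp add: uu)
next
  case False
  then show ?thesis by (simp add: Gamma_matrix_def)
qed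

lemma Gamma_bound:
  fixes t :: "'m::cancel_monoid_mult"
  assumes "finite F"
  shows "(\<Sum>s\<in>F. (cmod (\<Sum>\<^sub>\<infinity>u. Gamma_matrix t s u * Rep_ell2 f u))\<^sup>2) \<le> (norm f)\<^sup>2"
proof -
  define D where "D = {s \<in> F. \<exists>u. s * u = t}"
  define h where "h = (\<lambda>s. THE u. s * u = t)"
  have h: "s * h s = t" if "s \<in> D" for s
  proof -
    from that obtain u where u: "s * u = t" by (auto simp: D_def)
    have "\<exists>!u. s * u = t"
      by (rule ex1I[of _ u]) (use u in \<open>auto simp: cancel_left[symmetric, of _ u s]\<close>)
    then show ?thesis unfolding h_def by (rule theI')
  qed
  have inj: "inj_on h D"
  proof (rule inj_onI)
    fix s s' assume "s \<in> D" "s' \<in> D" "h s = h s'"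
    then have "s * h s = s' * h s" using h by metis
    then show "s = s'" by (simp add: cancel_right)
  qed
  have "(\<Sum>s\<in>F. (cmod (\<Sum>\<^sub>\<infinity>u. Gamma_matrix t s u * Rep_ell2 f u))\<^sup>2) = (\<Sum>s\<in>D. (cmod (Rep_ell2 f (h s)))\<^sup>2)"
    unfolding Gamma_infsum h_def
    by (rule sum.mono_neutral_cong_right) (auto simp: D_def assms)
  also have "\<dots> = (\<Sum>u\<in>h ` D. (cmod (Rep_ell2 f u))\<^sup>2)"
    by (simp add: sum.reindex[OF inj])
  also have "\<dots> \<le> (norm f)\<^sup>2"
    using assms by (intro sum_le_norm_ell2) (auto simp: D_def)
  finally show ?thesis .
qed

lift_definition Gamma_op :: "'m::cancel_monoid_mult \<Rightarrow> ('m ell2 \<Rightarrow>\<^sub>L 'm ell2)"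
  is "\<lambda>t f. Abs_ell2 (\<lambda>s. \<Sum>\<^sub>\<infinity>u. Gamma_matrix t s u * Rep_ell2 f u)"
proof -
  fix t :: 'm
  have r: "Rep_ell2 (Abs_ell2 (\<lambda>s. \<Sum>\<^sub>\<infinity>u. Gamma_matrix t s u * Rep_ell2 f u)) =
      (\<lambda>s. \<Sum>\<^sub>\<infinity>u. Gamma_matrix t s u * Rep_ell2 f u)" for f
    by (rule Abs_ell2_inverse, simp, rule sq_summable_boundedI(1)) (rule Gamma_bound)
  show "bounded_linear (\<lambda>f. Abs_ell2 (\<lambda>s. \<Sum>\<^sub>\<infinity>u. Gamma_matrix t s u * Rep_ell2 f u))"
  proof (rule bounded_linear_intro[where K = 1])
    fix f g :: "'m ell2" and c :: real
    show "Abs_ell2 (\<lambda>s. \<Sum>\<^sub>\<infinity>u. Gamma_matrix t s u * Rep_ell2 (f + g) u) =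
        Abs_ell2 (\<lambda>s. \<Sum>\<^sub>\<infinity>u. Gamma_matrix t s u * Rep_ell2 f u) +
        Abs_ell2 (\<lambda>s. \<Sum>\<^sub>\<infinity>u. Gamma_matrix t s u * Rep_ell2 g u)"
      by (rule ell2_eqI, unfold r, simp only: plus_ell2.rep_eq r) (simp add: plus_ell2.rep_eq Gamma_infsum)
    show "Abs_ell2 (\<lambda>s. \<Sum>\<^sub>\<infinity>u. Gamma_matrix t s u * Rep_ell2 (c *\<^sub>R f) u) =
        c *\<^sub>R Abs_ell2 (\<lambda>s. \<Sum>\<^sub>\<infinity>u. Gamma_matrix t s u * Rep_ell2 f u)"
      by (rule ell2_eqI, unfold r, simp only: scaleR_ell2.rep_eq r) (simp add: scaleR_ell2.rep_eq Gamma_infsum)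
    show "norm (Abs_ell2 (\<lambda>s. \<Sum>\<^sub>\<infinity>u. Gamma_matrix t s u * Rep_ell2 f u)) \<le> norm f * 1"
      by (rule norm_ell2_le) (auto simp: r Gamma_bound)
  qed
qed

lemma Rep_Gamma_op: "Rep_ell2 (Gamma_op t f) s = (\<Sum>\<^sub>\<infinity>u. Gamma_matrix t s u * Rep_ell2 f u)"
proof -
  have "sq_summable (\<lambda>s. \<Sum>\<^sub>\<infinity>u. Gamma_matrix t s u * Rep_ell2 f u)"
    by (rule sq_summable_boundedI(1)) (rule Gamma_bound)
  then show ?thesis by (simp add: Gamma_op.rep_eq Abs_ell2_inverse)
qed

lemma Gamma_op_matrix: "Rep_ell2 (Gamma_op t (ket s2)) s1 = Gamma_matrix t s1 s2"
proof -
  have "(\<Sum>\<^sub>\<infinity>u. Gamma_matrix t s1 u * Rep_ell2 (ket s2) u) = (\<Sum>\<^sub>\<infinity>u\<in>{s2}. Gamma_matrix t s1 u)"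
    by (rule infsum_cong_neutral) (auto simp: ket.rep_eq)
  then show ?thesis by (simp add: Rep_Gamma_op)
qed

lemma complex_linear_Gamma_op: "complex_linear (Gamma_op t)"
  unfolding complex_linear_def
  by (intro allI ell2_eqI) (simp add: Rep_Gamma_op Gamma_infsum scaleC_ell2.rep_eq)

lift_definition proj_ell2 :: "'a set \<Rightarrow> ('a ell2 \<Rightarrow>\<^sub>L 'a ell2)"
  is "\<lambda>S f. Abs_ell2 (\<lambda>x. if x \<in> S then Rep_ell2 f x else 0)"
proof -
  fix S :: "'a set"
  have r: "Rep_ell2 (Abs_ell2 (\<lambda>x. if x \<in> S then Rep_ell2 f x else 0)) =
      (\<lambda>x. if x \<in> S then Rep_ell2 f x else 0)" for f
    by (rule Abs_ell2_inverse, simp, rule sq_summable_le[OF sq_summable_Rep_ell2[of f]]) simp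
  show "bounded_linear (\<lambda>f. Abs_ell2 (\<lambda>x. if x \<in> S then Rep_ell2 f x else 0))"
  proof (rule bounded_linear_intro[where K = 1])
    fix f g :: "'a ell2" and c :: real
    show "Abs_ell2 (\<lambda>x. if x \<in> S then Rep_ell2 (f + g) x else 0) =
        Abs_ell2 (\<lambda>x. if x \<in> S then Rep_ell2 f x else 0) +
        Abs_ell2 (\<lambda>x. if x \<in> S then Rep_ell2 g x else 0)"
      by (rule ell2_eqI, unfold r, simp only: plus_ell2.rep_eq r) (simp add: plus_ell2.rep_eq)
    show "Abs_ell2 (\<lambda>x. if x \<in> S then Rep_ell2 (c *\<^sub>R f) x else 0) =
        c *\<^sub>R Abs_ell2 (\<lambda>x. if x \<in> S then Rep_ell2 f x else 0)"
      by (rule ell2_eqI, unfold r, simp only: scaleR_ell2.rep_eq r) (simp add: scaleR_ell2.rep_eq)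
    show "norm (Abs_ell2 (\<lambda>x. if x \<in> S then Rep_ell2 f x else 0)) \<le> norm f * 1"
    proof (rule norm_ell2_le)
      fix F :: "'a set" assume "finite F"
      have "(\<Sum>x\<in>F. (cmod (if x \<in> S then Rep_ell2 f x else 0))\<^sup>2) \<le> (\<Sum>x\<in>F. (cmod (Rep_ell2 f x))\<^sup>2)"
        by (intro sum_mono) simp
      also have "\<dots> \<le> (norm f)\<^sup>2" by (rule sum_le_norm_ell2) fact
      finally show "(\<Sum>x\<in>F. (cmod (Rep_ell2 (Abs_ell2 (\<lambda>x. if x \<in> S then Rep_ell2 f x else 0)) x))\<^sup>2)
          \<le> (norm f * 1)\<^sup>2" by (simp add: r)
    qed simp
  qed
qed

lemma Rep_proj_ell2: "Rep_ell2 (proj_ell2 S f) x = (if x \<in> S then Rep_ell2 f x else 0)"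
proof -
  have "sq_summable (\<lambda>x. if x \<in> S then Rep_ell2 f x else 0)"
    by (rule sq_summable_le[OF sq_summable_Rep_ell2[of f]]) simp
  then show ?thesis by (simp add: proj_ell2.rep_eq Abs_ell2_inverse)
qed

lemma complex_linear_proj_ell2: "complex_linear (proj_ell2 S)"
  unfolding complex_linear_def
  by (intro allI ell2_eqI) (simp add: Rep_proj_ell2 scaleC_ell2.rep_eq)

definition lunar :: "'m::cancel_monoid_mult itself \<Rightarrow> bool" where
  "lunar _ \<longleftrightarrow> (\<forall>a b c d x y z w :: 'm.
     a * x = b * y \<and> c * x = d * y \<and> a * z = b * w \<longrightarrow> c * z = d * w)"

end

theory Submission
  imports Defs
begin

text \<open>Write \<open>x\<^sub>t\<close> for the compression of the Gamma operator of \<open>t\<close>, and let \<open>B\<^sub>t\<close> be finitely many operators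
  on \<open>\<ell>\<^sup>2('h)\<close>. The operator \<open>X = \<Sum>\<^sub>t B\<^sub>t \<otimes> x\<^sub>t\<close> has the block matrix \<open>X(s, u) = B\<^bsub>su\<^esub>\<close>, for \<open>s \<in> S1\<close> and
  \<open>u \<in> S2\<close>. The operator \<open>Y = \<Sum>\<^sub>t B\<^sub>t \<otimes> x\<^sub>t \<otimes> x\<^sub>t\<close> (the \<open>x\<^sub>t\<close> are real matrices) has rows and columns
  indexed by pairs, and \<open>Y((s, s'), (u, u'))\<close> is \<open>B\<^bsub>su\<^esub>\<close> if \<open>su = s'u'\<close>, and zero otherwise.

  Restricting \<open>Y\<close> to the diagonal pairs gives back \<open>X\<close>, so \<open>\<parallel>X\<parallel> \<le> \<parallel>Y\<parallel>\<close>. Conversely, call the row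
  \<open>(s, s')\<close> and the column \<open>(u, u')\<close> adjacent if \<open>su = s'u'\<close>. The lunar condition says precisely that a
  path of length three in this bipartite graph closes up to a 4-cycle, i.e. that the graph is a
  disjoint union of complete bipartite graphs. Hence \<open>Y\<close> is block diagonal, and by cancellation the
  first component is injective on the rows, and on the columns, of a block. So every block is a
  submatrix of \<open>X\<close>, and \<open>\<parallel>Y\<parallel> \<le> \<parallel>X\<parallel>\<close>.

  The direct sum of the blocks is handled in one stroke: label a block by the common
  set of neighbours of its rows. Then \<open>Y = V (X \<otimes> 1) W\<close>, where \<open>1\<close> acts on \<open>\<ell>\<^sup>2\<close> of the labels and \<open>V\<close>, \<open>W\<close>
  are contractions whose matrices are those of partial bijections.\<close>

section \<open>Pulling vectors back along partial bijections\<close>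

text \<open>A relation \<open>R\<close> is read as a 0/1-matrix with at most one entry 1 per row, which sends \<open>f\<close> to \<open>k\<close>.
  Stating this as a relation between \<open>f\<close> and \<open>k\<close> avoids choosing the index \<open>y\<close> that belongs to \<open>x\<close>.\<close>

definition pulled_back :: "('a \<Rightarrow> 'b \<Rightarrow> bool) \<Rightarrow> 'b ell2 \<Rightarrow> 'a ell2 \<Rightarrow> bool" where
  "pulled_back R f k \<longleftrightarrow>
    (\<forall>x y. R x y \<longrightarrow> Rep_ell2 k x = Rep_ell2 f y) \<and>
    (\<forall>x. (\<nexists>y. R x y) \<longrightarrow> Rep_ell2 k x = 0)"

definition pullback_op :: "('a \<Rightarrow> 'b \<Rightarrow> bool) \<Rightarrow> ('b ell2 \<Rightarrow>\<^sub>L 'a ell2) \<Rightarrow> bool" where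
  "pullback_op R x \<longleftrightarrow> (\<forall>f. pulled_back R f (x f))"

lemma pulled_backD:
  assumes "pulled_back R f k"
  shows "R x y \<Longrightarrow> Rep_ell2 k x = Rep_ell2 f y"
    and "(\<And>y. \<not> R x y) \<Longrightarrow> Rep_ell2 k x = 0"
  using assms unfolding pulled_back_def by blast+

lemma pullback_opD:
  assumes "pullback_op R x"
  shows "R s u \<Longrightarrow> Rep_ell2 (x f) s = Rep_ell2 f u"
    and "(\<And>u. \<not> R s u) \<Longrightarrow> Rep_ell2 (x f) s = 0"
  using assms unfolding pullback_op_def pulled_back_def by blast+

text \<open>Pulling back along a partial bijection is a contraction: the entries of the new vector are
  entries of \<open>f\<close>, none used twice, and zeros.\<close>

lemma pulled_back_exists:
  fixes f :: "'b ell2" and R :: "'a \<Rightarrow> 'b \<Rightarrow> bool"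
  assumes right_unique: "\<And>x y y'. R x y \<Longrightarrow> R x y' \<Longrightarrow> y = y'"
    and left_unique: "\<And>x x' y. R x y \<Longrightarrow> R x' y \<Longrightarrow> x = x'"
  obtains k where "pulled_back R f k" "norm k \<le> norm f"
proof -
  define r where "r x = (SOME y. R x y)" for x
  have r: "R x (r x)" if "R x y" for x y
    unfolding r_def using that by (rule someI)
  define k where "k x = (if \<exists>y. R x y then Rep_ell2 f (r x) else 0)" for x
  have bound: "(\<Sum>x\<in>F. (cmod (k x))\<^sup>2) \<le> (norm f)\<^sup>2" if "finite F" for F
  proof -
    let ?D = "{x \<in> F. \<exists>y. R x y}"
    have "(\<Sum>x\<in>F. (cmod (k x))\<^sup>2) = (\<Sum>x\<in>?D. (cmod (Rep_ell2 f (r x)))\<^sup>2)"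
      by (rule sum.mono_neutral_cong_right) (use that in \<open>auto simp: k_def\<close>)
    also have "\<dots> = (\<Sum>y\<in>r ` ?D. (cmod (Rep_ell2 f y))\<^sup>2)"
    proof -
      have "inj_on r ?D"
      proof (rule inj_onI)
        fix x x' assume "x \<in> ?D" "x' \<in> ?D" and eq: "r x = r x'"
        then have "R x (r x)" "R x' (r x')" using r by blast+
        then show "x = x'" using left_unique eq by metis
      qed
      then show ?thesis by (simp add: sum.reindex)
    qed
    also have "\<dots> \<le> (norm f)\<^sup>2"
      using that by (intro sum_le_norm_ell2) auto
    finally show ?thesis .
  qed
  have "sq_summable k"
    by (rule sq_summable_boundedI(1)) (rule bound)
  then have Rep: "Rep_ell2 (Abs_ell2 k) = k"
    by (simp add: Abs_ell2_inverse)
  show ?thesis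
  proof (rule that)
    show "pulled_back R f (Abs_ell2 k)"
      unfolding pulled_back_def Rep k_def using r right_unique by auto metis
    show "norm (Abs_ell2 k) \<le> norm f"
      by (rule norm_ell2_le) (auto simp: Rep bound)
  qed
qed

lemma pullback_op_conj:
  assumes "pullback_op R x"
  shows "pullback_op R (conj_op x)"
  unfolding pullback_op_def pulled_back_def conj_op_def
  by (auto simp: Rep_conj_ell2 pullback_opD[OF assms])

section \<open>Tensor products with pullback operators\<close>

lemma slice_tensor_op:
  "slice (tensor_op B x g) s = B (slice (swap_ell2 (ampl x (swap_ell2 g))) s)"
  by (rule ell2_eqI) (simp add: tensor_op_def slice.rep_eq Rep_ampl)

text \<open>Row \<open>s\<close> of the block matrix of \<open>B \<otimes> x\<close> has at most one nonzero block, and that block is \<open>B\<close>. Thus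
  identities between such operators can be checked one slice at a time, without infinite sums.\<close>

lemma slice_tensor_pullback:
  assumes "pullback_op R x"
  shows "R s u \<Longrightarrow> slice (tensor_op B x g) s = B (slice g u)"
    and "(\<And>u. \<not> R s u) \<Longrightarrow> slice (tensor_op B x g) s = 0"
proof -
  assume "R s u"
  then have "slice (swap_ell2 (ampl x (swap_ell2 g))) s = slice g u"
    by (intro ell2_eqI)
       (simp add: slice.rep_eq Rep_swap_ell2 Rep_ampl pullback_opD(1)[OF assms])
  then show "slice (tensor_op B x g) s = B (slice g u)"
    by (simp add: slice_tensor_op)
next
  assume "\<And>u. \<not> R s u"
  then have "slice (swap_ell2 (ampl x (swap_ell2 g))) s = 0"
    by (intro ell2_eqI)
       (simp add: slice.rep_eq Rep_swap_ell2 Rep_ampl pullback_opD(2)[OF assms] zero_ell2.rep_eq)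
  then show "slice (tensor_op B x g) s = 0"
    by (simp add: slice_tensor_op blinfun.zero_right)
qed

lemma pullback_op_tensor:
  assumes x: "pullback_op R x" and y: "pullback_op Q y"
  shows "pullback_op (\<lambda>(s, s') (u, u'). R s u \<and> Q s' u') (tensor_op x y)"
proof -
  have slice: "Rep_ell2 (tensor_op x y f) (s, s') = Rep_ell2 (slice (tensor_op x y f) s') s" for f s s'
    by (simp add: slice.rep_eq)
  have hit: "Rep_ell2 (tensor_op x y f) (s, s') = Rep_ell2 f (u, u')" if "R s u" "Q s' u'" for f s s' u u'
    unfolding slice slice_tensor_pullback(1)[OF y that(2)] pullback_opD(1)[OF x that(1)]
    by (simp add: slice.rep_eq)
  have miss: "Rep_ell2 (tensor_op x y f) (s, s') = 0" if "\<And>u u'. \<not> (R s u \<and> Q s' u')" for f s s'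
  proof (cases "\<exists>u'. Q s' u'")
    case True
    then have "\<not> R s u" for u using that by blast
    with True show ?thesis
      unfolding slice using slice_tensor_pullback(1)[OF y] pullback_opD(2)[OF x] by metis
  next
    case False
    then have "slice (tensor_op x y f) s' = 0"
      by (intro slice_tensor_pullback(2)[OF y]) blast
    then show ?thesis unfolding slice by (simp add: zero_ell2.rep_eq)
  qed
  show ?thesis
    unfolding pullback_op_def pulled_back_def using hit miss by auto
qed

lemma slice_sum: "slice (\<Sum>t\<in>T. f t) s = (\<Sum>t\<in>T. slice (f t) s)"
proof (induction T rule: infinite_finite_induct)
  case (insert t T)
  then show ?case by (simp add: slice_add)
qed (auto intro!: ell2_eqI simp: slice.rep_eq zero_ell2.rep_eq)

lemma slice_sum_tensor_op:
  "slice ((\<Sum>t\<in>T. tensor_op (B t) (x t)) g) s = (\<Sum>t\<in>T. slice (tensor_op (B t) (x t) g) s)"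
  by (simp add: blinfun.sum_left slice_sum)

lemma ell2_slice_eqI: "(\<And>s. slice f s = slice g s) \<Longrightarrow> f = g"
  by (rule ell2_eqI) (metis slice.rep_eq surj_pair)

lemma norm_ampl_le: "norm (ampl T f) \<le> norm T * norm f"
proof (rule norm_ell2_le)
  fix F :: "('a \<times> 'b) set" assume "finite F"
  have "Rep_ell2 (ampl T f) p = Rep_ell2 (T (slice f (snd p))) (fst p)" for p
    by (cases p) (simp add: Rep_ampl)
  with ampl_bound[OF \<open>finite F\<close>, of T f]
  show "(\<Sum>p\<in>F. (cmod (Rep_ell2 (ampl T f) p))\<^sup>2) \<le> (norm T * norm f)\<^sup>2"
    by (simp add: case_prod_unfold)
qed simp

section \<open>The compressed Gamma operators\<close>

definition factors :: "'m::monoid_mult set \<Rightarrow> 'm set \<Rightarrow> 'm \<Rightarrow> 'm \<Rightarrow> 'm \<Rightarrow> bool" where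
  "factors S1 S2 t s u \<longleftrightarrow> s \<in> S1 \<and> u \<in> S2 \<and> s * u = t"

lemma pullback_op_Gamma:
  fixes S1 S2 :: "'m::cancel_monoid_mult set"
  shows "pullback_op (factors S1 S2 t) (proj_ell2 S1 o\<^sub>L Gamma_op t o\<^sub>L proj_ell2 S2)"
proof -
  have THE: "(THE v. s * v = s * u) = u" for s u :: 'm
    by (simp add: cancel_left)
  show ?thesis
    unfolding pullback_op_def pulled_back_def factors_def
    by (auto simp: Rep_proj_ell2 Rep_Gamma_op Gamma_infsum THE cancel_left)
qed

text \<open>The columns adjacent to the row \<open>(s, s')\<close>; this set is the label of the block of \<open>(s, s')\<close>.\<close>

definition neighbours :: "'m::monoid_mult set \<Rightarrow> 'm set \<Rightarrow> 'm \<times> 'm \<Rightarrow> ('m \<times> 'm) set" where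
  "neighbours S1 S2 = (\<lambda>(s, s'). {(u, u'). s \<in> S1 \<and> s' \<in> S1 \<and> u \<in> S2 \<and> u' \<in> S2 \<and> s * u = s' * u'})"

lemma mem_neighbours:
  "(u, u') \<in> neighbours S1 S2 (s, s') \<longleftrightarrow>
    s \<in> S1 \<and> s' \<in> S1 \<and> u \<in> S2 \<and> u' \<in> S2 \<and> s * u = s' * u'"
  by (simp add: neighbours_def)

text \<open>This is where cancellation is used: in \<open>su = s'u'\<close> any three of the elements determine the fourth.
  Hence forgetting the second components maps the rows and the columns of a block injectively to
  rows and columns of \<open>X\<close>.\<close>

lemma neighbours_cancel:
  fixes S1 S2 :: "'m::cancel_monoid_mult set"
  shows "q \<in> neighbours S1 S2 p \<Longrightarrow> q' \<in> neighbours S1 S2 p \<Longrightarrow> fst q = fst q' \<Longrightarrow> q = q'"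
    and "q \<in> neighbours S1 S2 p \<Longrightarrow> q \<in> neighbours S1 S2 p' \<Longrightarrow> fst p = fst p' \<Longrightarrow> p = p'"
proof -
  have mult: "fst p * fst q = snd p * snd q" if "q \<in> neighbours S1 S2 p" for p q
    using that by (cases p, cases q) (simp add: mem_neighbours)
  show "q \<in> neighbours S1 S2 p \<Longrightarrow> q' \<in> neighbours S1 S2 p \<Longrightarrow> fst q = fst q' \<Longrightarrow> q = q'"
    using mult[of q p] mult[of q' p] by (simp add: prod_eq_iff cancel_left)
  show "q \<in> neighbours S1 S2 p \<Longrightarrow> q \<in> neighbours S1 S2 p' \<Longrightarrow> fst p = fst p' \<Longrightarrow> p = p'"
    using mult[of q p] mult[of q p'] by (simp add: prod_eq_iff cancel_right)
qed

text \<open>Rows with a common neighbour have the same neighbours: this is where the lunar condition is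
  used, and it makes the label of a block a function of any of its columns.\<close>

lemma lunar_neighbours_eq:
  fixes S1 S2 :: "'m::cancel_monoid_mult set"
  assumes "lunar TYPE('m)" "q \<in> neighbours S1 S2 p" "q \<in> neighbours S1 S2 p'"
  shows "neighbours S1 S2 p = neighbours S1 S2 p'"
proof -
  obtain x y where q: "q = (x, y)" by (metis surj_pair)
  have sub: "neighbours S1 S2 r \<subseteq> neighbours S1 S2 r'"
    if r: "q \<in> neighbours S1 S2 r" and r': "q \<in> neighbours S1 S2 r'" for r r'
  proof -
    obtain a b c d where rr': "r = (a, b)" "r' = (c, d)" by (metis surj_pair)
    have ab: "a * x = b * y" and cd: "c * x = d * y" "c \<in> S1" "d \<in> S1"
      using r r' by (simp_all add: rr' q mem_neighbours)
    have "c * z = d * w" if "a * z = b * w" for z w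
      using assms(1)[unfolded lunar_def, rule_format, of a x b y c d z w] ab cd that by blast
    then show ?thesis
      using cd by (auto simp: rr' mem_neighbours)
  qed
  show ?thesis using sub assms(2,3) by blast
qed

section \<open>The two norm inequalities\<close>

text \<open>Only the positions of the ones in the matrices of \<open>x\<^sub>t\<close> and \<open>y\<^sub>t = x\<^sub>t \<otimes> x\<^sub>t\<close> matter for comparing
  \<open>X\<close> and \<open>Y\<close>, so both are given through their relations.\<close>

context
  fixes S1 S2 :: "'m::cancel_monoid_mult set" and B :: "'m \<Rightarrow> ('h ell2 \<Rightarrow>\<^sub>L 'h ell2)"
    and x :: "'m \<Rightarrow> ('m ell2 \<Rightarrow>\<^sub>L 'm ell2)" and y :: "'m \<Rightarrow> (('m \<times> 'm) ell2 \<Rightarrow>\<^sub>L ('m \<times> 'm) ell2)"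
    and T :: "'m set"
  assumes x: "\<And>t. pullback_op (factors S1 S2 t) (x t)"
    and y: "\<And>t. pullback_op (\<lambda>(s, s') (u, u'). factors S1 S2 t s u \<and> factors S1 S2 t s' u') (y t)"
begin

private abbreviation (input) "X \<equiv> \<Sum>t\<in>T. tensor_op (B t) (x t)"
private abbreviation (input) "Y \<equiv> \<Sum>t\<in>T. tensor_op (B t) (y t)"

text \<open>The compression of \<open>Y\<close> to the diagonal pairs is \<open>X\<close>, because \<open>(s, s)\<close> and \<open>(u, u)\<close> are always
  adjacent and \<open>su = su'\<close> forces \<open>u = u'\<close>.\<close>

lemma norm_le_norm_diagonal: "norm X \<le> norm Y"
proof (rule norm_blinfun_bound)
  fix g :: "('h \<times> 'm) ell2"
  define W where "W = (\<lambda>(h :: 'h, u :: 'm, u' :: 'm) (h', v). h = h' \<and> u = v \<and> u' = v)"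
  define V where "V = (\<lambda>(h :: 'h, s :: 'm) (h', s1, s2). h = h' \<and> s1 = s \<and> s2 = s)"
  obtain k where k: "pulled_back W g k" "norm k \<le> norm g"
    by (rule pulled_back_exists[of W g]) (auto simp: W_def)
  obtain l where l: "pulled_back V (Y k) l" "norm l \<le> norm (Y k)"
    by (rule pulled_back_exists[of V "Y k"]) (auto simp: V_def)
  have k_slice: "slice k (u, u) = slice g u" for u
    by (rule ell2_eqI) (simp add: slice.rep_eq pulled_backD(1)[OF k(1)] W_def)
  have "slice (tensor_op (B t) (x t) g) s = slice (tensor_op (B t) (y t) k) (s, s)" for t s
  proof (cases "\<exists>u. factors S1 S2 t s u")
    case True
    then obtain u where u: "factors S1 S2 t s u" by blast
    show ?thesis
      by (simp add: slice_tensor_pullback(1)[OF x u] u k_slice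
          slice_tensor_pullback(1)[OF y, of t "(s, s)" "(u, u)"])
  next
    case False
    then show ?thesis
      by (simp add: slice_tensor_pullback(2)[OF x, of t s]
          slice_tensor_pullback(2)[OF y, of t "(s, s)"] split_paired_all)
  qed
  then have "slice (X g) s = slice (Y k) (s, s)" for s
    by (simp add: slice_sum_tensor_op)
  also have "slice (Y k) (s, s) = slice l s" for s
    by (rule ell2_eqI)
       (simp add: slice.rep_eq pulled_backD(1)[OF l(1), of "(_, s)" "(_, s, s)"] V_def)
  finally have "X g = l" by (rule ell2_slice_eqI)
  then have "norm (X g) \<le> norm (Y k)" using l(2) by simp
  also have "\<dots> \<le> norm Y * norm k" by (rule norm_blinfun)
  also have "\<dots> \<le> norm Y * norm g" by (rule mult_left_mono[OF k(2)]) simp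
  finally show "norm (X g) \<le> norm Y * norm g" .
qed simp

text \<open>The factorisation \<open>Y = V (X \<otimes> 1) W\<close>: \<open>W\<close> sends the column \<open>(u, u')\<close> to the column \<open>u\<close> of the copy
  of \<open>X\<close> that belongs to the block of \<open>(u, u')\<close>, and \<open>V\<close> sends the row \<open>s\<close> of the copy with label \<open>N\<close>
  back to the row \<open>(s, s')\<close> whose set of neighbours is \<open>N\<close>.\<close>

lemma lunar_norm_le:
  assumes lunar: "lunar TYPE('m)"
  shows "norm Y \<le> norm X"
proof (rule norm_blinfun_bound)
  fix g :: "('h \<times> 'm \<times> 'm) ell2"
  let ?N = "neighbours S1 S2"
  define W where "W = (\<lambda>(a :: ('h \<times> 'm) \<times> ('m \<times> 'm) set) q.
    fst (fst a) = fst q \<and> snd (fst a) = fst (snd q) \<and> snd q \<in> snd a \<and> snd a \<in> range ?N)"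
  define V where "V = (\<lambda>(a :: 'h \<times> 'm \<times> 'm) q.
    fst a = fst (fst q) \<and> fst (snd a) = snd (fst q) \<and> snd q = ?N (snd a) \<and> snd q \<noteq> {})"
  obtain k where k: "pulled_back W g k" "norm k \<le> norm g"
  proof (rule pulled_back_exists)
    show "q = q'" if W: "W a q" "W a q'" for a q q'
    proof -
      obtain p where p: "snd a = ?N p" using W(1) unfolding W_def by blast
      have "snd q \<in> ?N p" "snd q' \<in> ?N p" "fst (snd q) = fst (snd q')"
        using W p unfolding W_def by simp_all
      then have "snd q = snd q'" by (rule neighbours_cancel(1))
      with W show ?thesis by (simp add: W_def prod_eq_iff)
    qed
    \<comment> \<open>A column lies in one block only.\<close>
    show "a = a'" if W: "W a q" "W a' q" for a a' q
    proof -
      obtain p p' where p: "snd a = ?N p" "snd a' = ?N p'" using W unfolding W_def by blast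
      have "snd q \<in> ?N p" "snd q \<in> ?N p'" using W p unfolding W_def by simp_all
      with lunar have "?N p = ?N p'" by (rule lunar_neighbours_eq)
      with W p show ?thesis by (simp add: W_def prod_eq_iff)
    qed
  qed
  obtain l where l: "pulled_back V (ampl X k) l" "norm l \<le> norm (ampl X k)"
  proof (rule pulled_back_exists)
    show "q = q'" if "V a q" "V a q'" for a q q'
      using that unfolding V_def by (simp add: prod_eq_iff)
    \<comment> \<open>Only blocks with a column contribute rows, so that this column can be cancelled.\<close>
    show "a = a'" if V: "V a q" "V a' q" for a a' q
    proof -
      from V have N: "?N (snd a) = ?N (snd a')" and fst: "fst (snd a) = fst (snd a')"
        by (simp_all add: V_def)
      from V obtain r where "r \<in> ?N (snd a)" unfolding V_def by auto
      then have "snd a = snd a'"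
        using N fst neighbours_cancel(2)[of r S1 S2 "snd a" "snd a'"] by simp
      with V show ?thesis by (simp add: V_def prod_eq_iff)
    qed
  qed
  have "slice (Y g) (s, s') = slice l (s, s')" for s s'
  proof -
    let ?k = "slice k (?N (s, s'))"
    have k_in: "slice ?k u = slice g (u, u')" if "(u, u') \<in> ?N (s, s')" for u u'
      by (rule ell2_eqI) (use that in \<open>simp add: slice.rep_eq pulled_backD(1)[OF k(1)] W_def\<close>)
    have k_out: "slice ?k u = 0" if "\<And>u'. (u, u') \<notin> ?N (s, s')" for u
    proof (rule ell2_eqI)
      fix h
      have "\<not> W ((h, u), ?N (s, s')) q" for q
        using that[of "snd (snd q)"] unfolding W_def by auto
      then show "Rep_ell2 (slice ?k u) h = Rep_ell2 0 h"
        by (simp add: slice.rep_eq pulled_backD(2)[OF k(1)] zero_ell2.rep_eq)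
    qed
    have summand: "slice (tensor_op (B t) (y t) g) (s, s') = slice (tensor_op (B t) (x t) ?k) s"
      if "s \<in> S1" "s' \<in> S1" for t
    proof (cases "\<exists>u. factors S1 S2 t s u")
      case True
      then obtain u where u: "factors S1 S2 t s u" by blast
      show ?thesis
      proof (cases "\<exists>u'. factors S1 S2 t s' u'")
        case True
        then obtain u' where u': "factors S1 S2 t s' u'" by blast
        with u have "(u, u') \<in> ?N (s, s')"
          by (auto simp: mem_neighbours factors_def)
        then show ?thesis
          by (simp add: slice_tensor_pullback(1)[OF x u] u u' k_in
              slice_tensor_pullback(1)[OF y, of t "(s, s')" "(u, u')"])
      next
        case False
        then have "(u, u') \<notin> ?N (s, s')" for u'
          using u by (auto simp: mem_neighbours factors_def)
        then have "slice ?k u = 0" by (rule k_out)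
        then show ?thesis
          using False
          by (simp add: slice_tensor_pullback(1)[OF x u] blinfun.zero_right
              slice_tensor_pullback(2)[OF y, of t "(s, s')"] split_paired_all)
      qed
    next
      case False
      then show ?thesis
        by (simp add: slice_tensor_pullback(2)[OF x, of t s]
            slice_tensor_pullback(2)[OF y, of t "(s, s')"] split_paired_all)
    qed
    show ?thesis
    proof (cases "?N (s, s') = {}")
      case True
      have "slice (tensor_op (B t) (y t) g) (s, s') = 0" for t
        by (rule slice_tensor_pullback(2)[OF y])
           (use True in \<open>fastforce simp: factors_def neighbours_def\<close>)
      moreover have "slice l (s, s') = 0"
        by (rule ell2_eqI)
           (use True in \<open>auto simp: slice.rep_eq zero_ell2.rep_eq V_def intro!: pulled_backD(2)[OF l(1)]\<close>)
      ultimately show ?thesis by (simp add: slice_sum_tensor_op)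
    next
      case False
      then have "s \<in> S1" "s' \<in> S1" by (auto simp: neighbours_def)
      then have "slice (Y g) (s, s') = slice (X ?k) s"
        by (simp add: slice_sum_tensor_op summand)
      also have "\<dots> = slice l (s, s')"
      proof (rule ell2_eqI)
        fix h
        have "V (h, s, s') ((h, s), ?N (s, s'))" using False by (simp add: V_def)
        from pulled_backD(1)[OF l(1) this]
        show "Rep_ell2 (slice (X ?k) s) h = Rep_ell2 (slice l (s, s')) h"
          by (simp add: slice.rep_eq Rep_ampl)
      qed
      finally show ?thesis .
    qed
  qed
  then have "Y g = l" by (intro ell2_slice_eqI) auto
  then have "norm (Y g) \<le> norm (ampl X k)" using l(2) by simp
  also have "\<dots> \<le> norm X * norm k" by (rule norm_ampl_le)
  also have "\<dots> \<le> norm X * norm g" by (rule mult_left_mono[OF k(2)]) simp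
  finally show "norm (Y g) \<le> norm X * norm g" .
qed simp

end

theorem theorem4p1:
  fixes S1 S2 :: "'m::cancel_monoid_mult set"
  assumes "lunar TYPE('m)"
  shows "SAP TYPE('b::cstar_algebra) TYPE('h)
    (\<lambda>t::'m. proj_ell2 S1 o\<^sub>L Gamma_op t o\<^sub>L proj_ell2 S2)"
proof -
  let ?x = "\<lambda>t::'m. proj_ell2 S1 o\<^sub>L Gamma_op t o\<^sub>L proj_ell2 S2"
  note x = pullback_op_Gamma[of S1 S2]
  note y = pullback_op_tensor[OF x pullback_op_conj[OF x]]
  have "complex_linear (?x t)" for t
    using complex_linear_proj_ell2[of S1] complex_linear_proj_ell2[of S2] complex_linear_Gamma_op[of t]
    by (simp add: complex_linear_def)
  moreover have "min_norm \<pi> b ?x = min_norm \<pi> b (\<lambda>t. tensor_op (?x t) (conj_op (?x t)))"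
    for \<pi> :: "'b \<Rightarrow> ('h ell2 \<Rightarrow>\<^sub>L 'h ell2)" and b
    unfolding min_norm_def
    by (rule antisym[OF norm_le_norm_diagonal[OF x y] lunar_norm_le[OF x y assms]])
  ultimately show ?thesis
    unfolding SAP_def by blast
qed

end
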